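(* Let $G$ be a finite group and let $p$ be the smallest prime number dividing the order of $G$. Then for all $n\ge 1$, $$D^{\wedge}_{n}(G)\leq\frac{1}{p^{n-1}}d(G)+\frac{(1-p)|Z(G)|-\left(1-p^nD^{\wedge}_{n-1}(G)\right)|Z^{\wedge}(G)|}{p^n|G|}.$$
   Context: For a group $G$ write ${}^hg=hgh^{-1}$. The tensor square $G\otimes G$ is the group generated by symbols $g\otimes h$ ($g,h\in G$) subject to $gk\otimes h=({}^gk\otimes {}^gh)(g\otimes h)$ and $g\otimes hk=(g\otimes h)({}^hg\otimes {}^hk)$ for all $g,h,k\in G$. The exterior square $G\wedge G$ is the quotient of $G\otimes G$ obtained by imposing the additional relations $g\otimes g=1$ for all $g\in G$; the image of $x\otimes y$ is denoted $x\wedge y$. For $x\in G$, the exterior centralizer is the subgroup $C^{\wedge}_G(x)=\{y\in G: x\wedge y=1\}$, and the exterior center is $Z^{\wedge}(G)=\bigcap_{x\in G}C^{\wedge}_G(x)$. $Z(G)$ is the center of $G$. For a finite group $G$ and an integer $n\ge 0$, the multiple exterior degree is $$D^{\wedge}_n(G)=\frac{|\{(x_1,\dots,x_{n+1})\in G^{n+1}: x_i\wedge x_j=1 \text{ in } G\wedge G \text{ for all } 1\le i,j\le n+1\}|}{|G|^{n+1}},$$ so $D^{\wedge}_0(G)=1$. The commutativity degree is $d(G)=|\{(x,y)\in G^2: xy=yx\}|/|G|^2=k(G)/|G|$, where $k(G)$ is the number of conjugacy classes of $G$. *)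

theory Defs
  imports Complex_Main "HOL-Algebra.Coset" "HOL-Computational_Algebra.Primes" "HOL-Library.FuncSet"
begin

section \<open>Groups given by generators and relations\<close>

text \<open>The letter \<open>(x, True)\<close> stands for the generator \<open>x\<close> and \<open>(x, False)\<close> for its formal inverse.\<close>

type_synonym 'a gword = "('a \<times> bool) list"

definition gwords :: "'a set \<Rightarrow> 'a gword set" where
  "gwords X = lists (X \<times> UNIV)"

text \<open>The least congruence on the monoid of words which makes the letters mutually inverse and
  contains the relations; a pair \<open>(u, v) \<in> R\<close> stands for the relation \<open>u = v\<close>.\<close>

inductive word_eq :: "'a set \<Rightarrow> ('a gword \<times> 'a gword) set \<Rightarrow> 'a gword \<Rightarrow> 'a gword \<Rightarrow> bool"
  for X R where
  refl: "w \<in> gwords X \<Longrightarrow> word_eq X R w w"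
| sym: "word_eq X R u v \<Longrightarrow> word_eq X R v u"
| trans: "word_eq X R u v \<Longrightarrow> word_eq X R v w \<Longrightarrow> word_eq X R u w"
| mult: "word_eq X R u u' \<Longrightarrow> word_eq X R v v' \<Longrightarrow> word_eq X R (u @ v) (u' @ v')"
| cancel: "x \<in> X \<Longrightarrow> word_eq X R [(x, b), (x, \<not> b)] []"
| rel: "(u, v) \<in> R \<Longrightarrow> u \<in> gwords X \<Longrightarrow> v \<in> gwords X \<Longrightarrow> word_eq X R u v"

definition word_class :: "'a set \<Rightarrow> ('a gword \<times> 'a gword) set \<Rightarrow> 'a gword \<Rightarrow> 'a gword set" where
  "word_class X R w = {v. word_eq X R w v}"

definition presented_group :: "'a set \<Rightarrow> ('a gword \<times> 'a gword) set \<Rightarrow> 'a gword set monoid" where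
  "presented_group X R =
    \<lparr>carrier = word_class X R ` gwords X,
     monoid.mult = (\<lambda>A B. {w. \<exists>u\<in>A. \<exists>v\<in>B. word_eq X R (u @ v) w}),
     one = word_class X R []\<rparr>"

lemma word_eq_gwords: "word_eq X R u v \<Longrightarrow> u \<in> gwords X \<and> v \<in> gwords X"
  by (induction rule: word_eq.induct) (auto simp: gwords_def)

lemma word_class_eq_iff:
  "u \<in> gwords X \<Longrightarrow> word_class X R u = word_class X R v \<longleftrightarrow> word_eq X R u v"
  unfolding word_class_def by (blast intro: word_eq.refl word_eq.sym word_eq.trans)

lemma presented_group_mult:
  assumes "u \<in> gwords X" "v \<in> gwords X"
  shows "word_class X R u \<otimes>\<^bsub>presented_group X R\<^esub> word_class X R v = word_class X R (u @ v)"
  using assms unfolding presented_group_def word_class_def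
  by (auto intro: word_eq.refl word_eq.mult word_eq.trans)

lemma presented_group_left_inverse:
  assumes "w \<in> gwords X"
  shows "\<exists>v\<in>gwords X. word_eq X R (v @ w) []"
  using assms
proof (induction w)
  case Nil
  show ?case by (intro bexI[of _ "[]"]) (auto simp: gwords_def intro: word_eq.refl)
next
  case (Cons a w)
  obtain x b where a: "a = (x, b)" "x \<in> X" using Cons.prems by (cases a) (auto simp: gwords_def)
  have w: "w \<in> gwords X" using Cons.prems by (auto simp: gwords_def)
  then obtain v where v: "v \<in> gwords X" "word_eq X R (v @ w) []" using Cons.IH by blast
  have "word_eq X R [(x, \<not> b), (x, b)] []" using word_eq.cancel[OF a(2), of R "\<not> b"] by simp
  from word_eq.mult[OF word_eq.refl[OF v(1)] word_eq.mult[OF this word_eq.refl[OF w]]]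
  have "word_eq X R ((v @ [(x, \<not> b)]) @ a # w) []" using v(2) a by (auto intro: word_eq.trans)
  moreover have "v @ [(x, \<not> b)] \<in> gwords X" using v a by (auto simp: gwords_def)
  ultimately show ?case by blast
qed

lemma group_presented_group: "group (presented_group X R)"
proof -
  have app: "u @ v \<in> gwords X" if "u \<in> gwords X" "v \<in> gwords X" for u v :: "'a gword"
    using that by (auto simp: gwords_def)
  have nil: "[] \<in> gwords X" by (simp add: gwords_def)
  have car: "carrier (presented_group X R) = word_class X R ` gwords X"
    and one: "\<one>\<^bsub>presented_group X R\<^esub> = word_class X R []"
    by (simp_all add: presented_group_def)
  show ?thesis
  proof (rule groupI)
    fix A assume "A \<in> carrier (presented_group X R)"
    then obtain w where w: "w \<in> gwords X" "A = word_class X R w" by (auto simp: car)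
    obtain v where v: "v \<in> gwords X" "word_eq X R (v @ w) []"
      using presented_group_left_inverse[OF w(1)] by blast
    then have "word_class X R v \<otimes>\<^bsub>presented_group X R\<^esub> A = \<one>\<^bsub>presented_group X R\<^esub>"
      using w app by (simp add: presented_group_mult one word_class_eq_iff)
    then show "\<exists>B\<in>carrier (presented_group X R). B \<otimes>\<^bsub>presented_group X R\<^esub> A = \<one>\<^bsub>presented_group X R\<^esub>"
      using v by (auto simp: car)
  qed (auto simp: car one presented_group_mult app nil)
qed

definition normal_closure :: "('a, 'b) monoid_scheme \<Rightarrow> 'a set \<Rightarrow> 'a set" where
  "normal_closure T S = \<Inter>{N. N \<lhd> T \<and> S \<subseteq> N}"


section \<open>The tensor square and the exterior square\<close>

definition conjugate :: "('a, 'b) monoid_scheme \<Rightarrow> 'a \<Rightarrow> 'a \<Rightarrow> 'a" where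
  "conjugate G h g = h \<otimes>\<^bsub>G\<^esub> g \<otimes>\<^bsub>G\<^esub> inv\<^bsub>G\<^esub> h"

text \<open>The pair \<open>(g, h)\<close>, regarded as a generator, is the symbol \<open>g \<otimes> h\<close>.\<close>

definition tensor_relations ::
    "('a, 'b) monoid_scheme \<Rightarrow> (('a \<times> 'a) gword \<times> ('a \<times> 'a) gword) set" where
  "tensor_relations G =
    {([((g \<otimes>\<^bsub>G\<^esub> k, h), True)],
      [((conjugate G g k, conjugate G g h), True), ((g, h), True)]) | g h k.
        g \<in> carrier G \<and> h \<in> carrier G \<and> k \<in> carrier G} \<union>
    {([((g, h \<otimes>\<^bsub>G\<^esub> k), True)],
      [((g, h), True), ((conjugate G h g, conjugate G h k), True)]) | g h k.
        g \<in> carrier G \<and> h \<in> carrier G \<and> k \<in> carrier G}"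

definition tensor_square :: "('a, 'b) monoid_scheme \<Rightarrow> ('a \<times> 'a) gword set monoid" where
  "tensor_square G = presented_group (carrier G \<times> carrier G) (tensor_relations G)"

definition tensor :: "('a, 'b) monoid_scheme \<Rightarrow> 'a \<Rightarrow> 'a \<Rightarrow> ('a \<times> 'a) gword set" where
  "tensor G g h = word_class (carrier G \<times> carrier G) (tensor_relations G) [((g, h), True)]"

definition diagonal_subgroup :: "('a, 'b) monoid_scheme \<Rightarrow> ('a \<times> 'a) gword set set" where
  "diagonal_subgroup G = normal_closure (tensor_square G) ((\<lambda>g. tensor G g g) ` carrier G)"

definition exterior_square :: "('a, 'b) monoid_scheme \<Rightarrow> ('a \<times> 'a) gword set set monoid" where
  "exterior_square G = tensor_square G Mod diagonal_subgroup G"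

definition wedge :: "('a, 'b) monoid_scheme \<Rightarrow> 'a \<Rightarrow> 'a \<Rightarrow> ('a \<times> 'a) gword set set" where
  "wedge G x y = diagonal_subgroup G #>\<^bsub>tensor_square G\<^esub> tensor G x y"


section \<open>Centers and degrees\<close>

definition group_center :: "('a, 'b) monoid_scheme \<Rightarrow> 'a set" where
  "group_center G = {z \<in> carrier G. \<forall>x\<in>carrier G. z \<otimes>\<^bsub>G\<^esub> x = x \<otimes>\<^bsub>G\<^esub> z}"

definition exterior_centralizer :: "('a, 'b) monoid_scheme \<Rightarrow> 'a \<Rightarrow> 'a set" where
  "exterior_centralizer G x = {y \<in> carrier G. wedge G x y = \<one>\<^bsub>exterior_square G\<^esub>}"

definition exterior_center :: "('a, 'b) monoid_scheme \<Rightarrow> 'a set" where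
  "exterior_center G = (\<Inter>x\<in>carrier G. exterior_centralizer G x)"

definition multiple_exterior_degree :: "nat \<Rightarrow> ('a, 'b) monoid_scheme \<Rightarrow> real" where
  "multiple_exterior_degree n G =
    real (card {x \<in> {1..n + 1} \<rightarrow>\<^sub>E carrier G.
      \<forall>i\<in>{1..n + 1}. \<forall>j\<in>{1..n + 1}. wedge G (x i) (x j) = \<one>\<^bsub>exterior_square G\<^esub>})
    / real (order G) ^ (n + 1)"

definition commutativity_degree :: "('a, 'b) monoid_scheme \<Rightarrow> real" where
  "commutativity_degree G =
    real (card {(x, y) \<in> carrier G \<times> carrier G. x \<otimes>\<^bsub>G\<^esub> y = y \<otimes>\<^bsub>G\<^esub> x}) / real (order G) ^ 2"

end

theory Submission
  imports Defs
begin

text \<open>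
  Write \<open>N\<close> for the order of \<open>G\<close>, and \<open>C(x)\<close>, \<open>C\<^sup>\<and>(x)\<close> for the centralizer and the exterior
  centralizer of \<open>x\<close>. Call a tuple commuting in the exterior sense if all its entries have pairwise
  trivial wedge. Fix the last entry \<open>a\<close> of such an \<open>(n + 1)\<close>-tuple. The other entries form an
  \<open>n\<close>-tuple of the same kind with values in \<open>C\<^sup>\<and>(a)\<close>, and three bounds for their number are used.

  \<^item> If \<open>a \<in> Z\<^sup>\<and>(G)\<close>, there are at most \<open>N\<^sup>n D\<^sup>\<and>\<^bsub>n-1\<^esub>(G)\<close> of them, by definition.
  \<^item> If \<open>a \<in> Z(G) - Z\<^sup>\<and>(G)\<close>, then \<open>C\<^sup>\<and>(a)\<close> is a proper subgroup, so its index has a prime divisor,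
    hence is at least \<open>p\<close>, and there are at most \<open>(N/p)\<^sup>n\<close> such tuples.
  \<^item> If \<open>a \<notin> Z(G)\<close>, the previous bound is used for all coordinates but one, and \<open>C\<^sup>\<and>(a) \<subseteq> C(a)\<close> for
    the remaining one. This gives \<open>(N/p)\<^bsup>n-1\<^esup> |C(a)|\<close>.

  As the orders of all centralizers add up to \<open>N\<^sup>2 d(G)\<close>, and those of central elements contribute
  \<open>N |Z(G)|\<close>, summation over \<open>a\<close> and division by \<open>N\<^bsup>n+1\<^esup>\<close> yield exactly the stated bound.

  The facts about \<open>C\<^sup>\<and>(x)\<close> come from the universal property of the exterior square
  (\<open>wedge_trivial_imp\<close>): a function on pairs which satisfies the defining relations takes the value
  \<open>1\<close> at every pair with trivial wedge. Applied to the commutator it shows that elements with trivial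
  wedge commute; applied to the wedge of conjugates it shows that conjugation preserves
  triviality of wedges, and this makes \<open>C\<^sup>\<and>(x)\<close> a subgroup.
\<close>

section \<open>Homomorphisms out of a presented group\<close>

primrec word_value :: "('h, 'c) monoid_scheme \<Rightarrow> ('a \<Rightarrow> 'h) \<Rightarrow> 'a gword \<Rightarrow> 'h" where
  "word_value H f [] = \<one>\<^bsub>H\<^esub>"
| "word_value H f (a # w) =
    (if snd a then f (fst a) else inv\<^bsub>H\<^esub> f (fst a)) \<otimes>\<^bsub>H\<^esub> word_value H f w"

lemma word_value_closed:
  assumes "group H" "f \<in> X \<rightarrow> carrier H" "w \<in> gwords X"
  shows "word_value H f w \<in> carrier H"
proof -
  interpret group H by fact
  show ?thesis using assms(2,3)
    by (induction w) (auto simp: gwords_def Pi_iff)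
qed

lemma word_value_append:
  assumes "group H" "f \<in> X \<rightarrow> carrier H" "u \<in> gwords X" "v \<in> gwords X"
  shows "word_value H f (u @ v) = word_value H f u \<otimes>\<^bsub>H\<^esub> word_value H f v"
proof -
  interpret group H by fact
  show ?thesis using assms(3)
  proof (induction u)
    case Nil
    then show ?case using word_value_closed[OF assms(1,2,4)] by simp
  next
    case (Cons a u)
    then have "u \<in> gwords X" "fst a \<in> X" by (auto simp: gwords_def)
    moreover from this have "f (fst a) \<in> carrier H" using assms(2) by auto
    ultimately show ?case
      using Cons.IH word_value_closed[OF assms(1,2)] assms(4) by (simp add: m_assoc)
  qed
qed

lemma word_value_cong:
  assumes "group H" "f \<in> X \<rightarrow> carrier H"
    and rels: "\<And>u v. (u, v) \<in> R \<Longrightarrow> u \<in> gwords X \<Longrightarrow> v \<in> gwords X \<Longrightarrow>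
      word_value H f u = word_value H f v"
    and "word_eq X R u v"
  shows "word_value H f u = word_value H f v"
proof -
  interpret group H by fact
  show ?thesis using assms(4)
  proof (induction rule: word_eq.induct)
    case (mult u u' v v')
    then show ?case
      using word_eq_gwords word_value_append[OF assms(1,2)] by metis
  next
    case (cancel x b)
    then have "f x \<in> carrier H" using assms(2) by auto
    then show ?case by (cases b) simp_all
  qed (auto intro: rels)
qed

text \<open>By \<open>word_value_cong\<close> the value is constant on each class of words, so it descends to the
  presented group.\<close>

lemma presented_group_hom:
  assumes "group H" "f \<in> X \<rightarrow> carrier H"
    and rels: "\<And>u v. (u, v) \<in> R \<Longrightarrow> u \<in> gwords X \<Longrightarrow> v \<in> gwords X \<Longrightarrow>
      word_value H f u = word_value H f v"
  obtains \<phi> where "group_hom (presented_group X R) H \<phi>"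
    and "\<And>w. w \<in> gwords X \<Longrightarrow> \<phi> (word_class X R w) = word_value H f w"
proof -
  define \<phi> where "\<phi> A = the_elem (word_value H f ` A)" for A
  have \<phi>: "\<phi> (word_class X R w) = word_value H f w" if "w \<in> gwords X" for w
  proof -
    have "w \<in> word_class X R w" using that by (simp add: word_class_def word_eq.refl)
    moreover have "word_value H f ` word_class X R w \<subseteq> {word_value H f w}"
      using word_value_cong[OF assms] by (fastforce simp: word_class_def)
    ultimately have "word_value H f ` word_class X R w = {word_value H f w}" by blast
    then show ?thesis by (simp add: \<phi>_def)
  qed
  have "\<phi> \<in> hom (presented_group X R) H"
  proof (rule homI)
    fix A assume "A \<in> carrier (presented_group X R)"
    then show "\<phi> A \<in> carrier H"
      using \<phi> word_value_closed[OF assms(1,2)] by (auto simp: presented_group_def)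
  next
    fix A B assume "A \<in> carrier (presented_group X R)" "B \<in> carrier (presented_group X R)"
    then obtain u v where uv: "u \<in> gwords X" "A = word_class X R u"
      "v \<in> gwords X" "B = word_class X R v" by (auto simp: presented_group_def)
    moreover from this have "u @ v \<in> gwords X" by (simp add: gwords_def)
    ultimately show "\<phi> (A \<otimes>\<^bsub>presented_group X R\<^esub> B) = \<phi> A \<otimes>\<^bsub>H\<^esub> \<phi> B"
      using \<phi> word_value_append[OF assms(1,2)] by (simp add: presented_group_mult)
  qed
  then have "group_hom (presented_group X R) H \<phi>"
    using assms(1) by (simp add: group_hom_def group_hom_axioms_def group_presented_group)
  then show thesis using that \<phi> by blast
qed

section \<open>The exterior square and its universal property\<close>

lemma normal_normal_closure:
  assumes "group T" "S \<subseteq> carrier T"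
  shows "normal_closure T S \<lhd> T"
proof -
  interpret group T by fact
  have carr: "carrier T \<lhd> T" using subgroup_self by (auto simp: normal_inv_iff)
  have "subgroup (\<Inter>{N. N \<lhd> T \<and> S \<subseteq> N}) T"
    using carr assms(2) by (intro subgroups_Inter) (auto intro: normal_imp_subgroup)
  then show ?thesis
    unfolding normal_closure_def normal_inv_iff by auto
qed

lemma normal_closure_subset: "N \<lhd> T \<Longrightarrow> S \<subseteq> N \<Longrightarrow> normal_closure T S \<subseteq> N"
  by (auto simp: normal_closure_def)

lemma subset_normal_closure: "S \<subseteq> normal_closure T S"
  by (auto simp: normal_closure_def)

lemma group_tensor_square: "group (tensor_square G)"
  by (simp add: tensor_square_def group_presented_group)

lemma tensor_closed:
  "g \<in> carrier G \<Longrightarrow> h \<in> carrier G \<Longrightarrow> tensor G g h \<in> carrier (tensor_square G)"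
  by (auto simp: tensor_def tensor_square_def presented_group_def gwords_def)

lemma normal_diagonal_subgroup: "diagonal_subgroup G \<lhd> tensor_square G"
  unfolding diagonal_subgroup_def
  by (intro normal_normal_closure group_tensor_square) (auto simp: tensor_closed)

lemma group_exterior_square: "group (exterior_square G)"
  by (simp add: exterior_square_def normal.factorgroup_is_group normal_diagonal_subgroup)

lemma wedge_closed:
  "g \<in> carrier G \<Longrightarrow> h \<in> carrier G \<Longrightarrow> wedge G g h \<in> carrier (exterior_square G)"
  by (auto simp: wedge_def exterior_square_def FactGroup_def RCOSETS_def tensor_closed)

lemma wedge_trivial_iff:
  assumes "g \<in> carrier G" "h \<in> carrier G"
  shows "wedge G g h = \<one>\<^bsub>exterior_square G\<^esub> \<longleftrightarrow> tensor G g h \<in> diagonal_subgroup G"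
proof -
  interpret T: group "tensor_square G" by (rule group_tensor_square)
  have sub: "subgroup (diagonal_subgroup G) (tensor_square G)"
    by (rule normal_imp_subgroup[OF normal_diagonal_subgroup])
  have one: "\<one>\<^bsub>exterior_square G\<^esub> = diagonal_subgroup G"
    by (simp add: exterior_square_def FactGroup_def)
  show ?thesis
    unfolding one wedge_def
  proof
    assume "diagonal_subgroup G #>\<^bsub>tensor_square G\<^esub> tensor G g h = diagonal_subgroup G"
    then show "tensor G g h \<in> diagonal_subgroup G"
      by (rule T.coset_join1[OF _ tensor_closed[OF assms] sub])
  next
    assume "tensor G g h \<in> diagonal_subgroup G"
    then show "diagonal_subgroup G #>\<^bsub>tensor_square G\<^esub> tensor G g h = diagonal_subgroup G"
      by (rule T.coset_join2[OF tensor_closed[OF assms] sub])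
  qed
qed

lemma wedge_self: "g \<in> carrier G \<Longrightarrow> wedge G g g = \<one>\<^bsub>exterior_square G\<^esub>"
  using subset_normal_closure[of "(\<lambda>g. tensor G g g) ` carrier G" "tensor_square G"]
  by (simp add: wedge_trivial_iff diagonal_subgroup_def image_subset_iff)

lemma wedge_mult:
  assumes "a \<in> carrier G" "b \<in> carrier G" "c \<in> carrier G" "d \<in> carrier G"
  shows "wedge G a b \<otimes>\<^bsub>exterior_square G\<^esub> wedge G c d =
    diagonal_subgroup G #>\<^bsub>tensor_square G\<^esub> (tensor G a b \<otimes>\<^bsub>tensor_square G\<^esub> tensor G c d)"
  using assms by (simp add: wedge_def exterior_square_def FactGroup_def tensor_closed
    normal.rcos_sum[OF normal_diagonal_subgroup])

lemma conjugate_closed: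
  "group G \<Longrightarrow> h \<in> carrier G \<Longrightarrow> g \<in> carrier G \<Longrightarrow> conjugate G h g \<in> carrier G"
  by (simp add: conjugate_def group.is_monoid monoid.m_closed)

lemma wedge_mult_left:
  assumes "group G" "g \<in> carrier G" "k \<in> carrier G" "h \<in> carrier G"
  shows "wedge G (g \<otimes>\<^bsub>G\<^esub> k) h =
    wedge G (conjugate G g k) (conjugate G g h) \<otimes>\<^bsub>exterior_square G\<^esub> wedge G g h"
proof -
  interpret group G by fact
  let ?X = "carrier G \<times> carrier G" and ?R = "tensor_relations G"
  have "word_eq ?X ?R [((g \<otimes>\<^bsub>G\<^esub> k, h), True)]
      [((conjugate G g k, conjugate G g h), True), ((g, h), True)]"
    using assms by (intro word_eq.rel)
      (auto simp: tensor_relations_def gwords_def conjugate_closed)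
  then have "tensor G (g \<otimes>\<^bsub>G\<^esub> k) h =
      tensor G (conjugate G g k) (conjugate G g h) \<otimes>\<^bsub>tensor_square G\<^esub> tensor G g h"
    using assms unfolding tensor_def tensor_square_def
    by (subst presented_group_mult) (auto simp: word_class_eq_iff gwords_def conjugate_closed)
  then show ?thesis using assms by (simp add: wedge_mult conjugate_closed) (simp add: wedge_def)
qed

lemma wedge_mult_right:
  assumes "group G" "g \<in> carrier G" "k \<in> carrier G" "h \<in> carrier G"
  shows "wedge G g (h \<otimes>\<^bsub>G\<^esub> k) =
    wedge G g h \<otimes>\<^bsub>exterior_square G\<^esub> wedge G (conjugate G h g) (conjugate G h k)"
proof -
  interpret group G by fact
  let ?X = "carrier G \<times> carrier G" and ?R = "tensor_relations G"
  have "word_eq ?X ?R [((g, h \<otimes>\<^bsub>G\<^esub> k), True)]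
      [((g, h), True), ((conjugate G h g, conjugate G h k), True)]"
    using assms by (intro word_eq.rel)
      (auto simp: tensor_relations_def gwords_def conjugate_closed)
  then have "tensor G g (h \<otimes>\<^bsub>G\<^esub> k) =
      tensor G g h \<otimes>\<^bsub>tensor_square G\<^esub> tensor G (conjugate G h g) (conjugate G h k)"
    using assms unfolding tensor_def tensor_square_def
    by (subst presented_group_mult) (auto simp: word_class_eq_iff gwords_def conjugate_closed)
  then show ?thesis using assms by (simp add: wedge_mult conjugate_closed) (simp add: wedge_def)
qed

text \<open>The relations make \<open>f\<close> induce a homomorphism on the tensor square. Its kernel is a normal
  subgroup containing the diagonal symbols, hence all of the subgroup which is factored out.\<close>

lemma wedge_trivial_imp:
  assumes "group G" "group H"
    and closed: "\<And>g h. g \<in> carrier G \<Longrightarrow> h \<in> carrier G \<Longrightarrow> f g h \<in> carrier H"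
    and left: "\<And>g k h. g \<in> carrier G \<Longrightarrow> k \<in> carrier G \<Longrightarrow> h \<in> carrier G \<Longrightarrow>
      f (g \<otimes>\<^bsub>G\<^esub> k) h = f (conjugate G g k) (conjugate G g h) \<otimes>\<^bsub>H\<^esub> f g h"
    and right: "\<And>g h k. g \<in> carrier G \<Longrightarrow> h \<in> carrier G \<Longrightarrow> k \<in> carrier G \<Longrightarrow>
      f g (h \<otimes>\<^bsub>G\<^esub> k) = f g h \<otimes>\<^bsub>H\<^esub> f (conjugate G h g) (conjugate G h k)"
    and diag: "\<And>g. g \<in> carrier G \<Longrightarrow> f g g = \<one>\<^bsub>H\<^esub>"
    and xy: "x \<in> carrier G" "y \<in> carrier G" "wedge G x y = \<one>\<^bsub>exterior_square G\<^esub>"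
  shows "f x y = \<one>\<^bsub>H\<^esub>"
proof -
  interpret G: group G by fact
  interpret H: group H by fact
  let ?X = "carrier G \<times> carrier G" and ?R = "tensor_relations G"
  have F: "case_prod f \<in> ?X \<rightarrow> carrier H" using closed by auto
  have rels: "word_value H (case_prod f) u = word_value H (case_prod f) v"
    if "(u, v) \<in> ?R" for u v
    using that unfolding tensor_relations_def
    by (auto simp: closed left right conjugate_closed[OF assms(1)])
  obtain \<phi> where hom: "group_hom (tensor_square G) H \<phi>"
    and \<phi>: "\<And>w. w \<in> gwords ?X \<Longrightarrow> \<phi> (word_class ?X ?R w) = word_value H (case_prod f) w"
    using presented_group_hom[OF assms(2) F rels] unfolding tensor_square_def by blast
  have \<phi>_tensor: "\<phi> (tensor G g h) = f g h" if "g \<in> carrier G" "h \<in> carrier G" for g h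
    using that by (simp add: tensor_def \<phi> gwords_def closed)
  have "diagonal_subgroup G \<subseteq> kernel (tensor_square G) H \<phi>"
    unfolding diagonal_subgroup_def
    by (intro normal_closure_subset group_hom.normal_kernel[OF hom])
      (auto simp: kernel_def tensor_closed \<phi>_tensor diag)
  then show ?thesis
    using xy by (auto simp: wedge_trivial_iff kernel_def \<phi>_tensor)
qed

section \<open>Exterior centralizers\<close>

lemma conjugate_one:
  assumes "group G" "g \<in> carrier G"
  shows "conjugate G \<one>\<^bsub>G\<^esub> g = g"
proof -
  interpret group G by fact
  show ?thesis using assms(2) by (simp add: conjugate_def)
qed

lemma conjugate_self:
  assumes "group G" "g \<in> carrier G"
  shows "conjugate G g g = g"
proof -
  interpret group G by fact
  show ?thesis using assms(2) by (simp add: conjugate_def m_assoc)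
qed

lemma conjugate_mult:
  assumes "group G" "h \<in> carrier G" "a \<in> carrier G" "b \<in> carrier G"
  shows "conjugate G h (a \<otimes>\<^bsub>G\<^esub> b) = conjugate G h a \<otimes>\<^bsub>G\<^esub> conjugate G h b"
proof -
  interpret group G by fact
  show ?thesis using assms by (simp add: conjugate_def m_assoc inv_solve_left)
qed

lemma conjugate_conjugate:
  assumes "group G" "h \<in> carrier G" "k \<in> carrier G" "a \<in> carrier G"
  shows "conjugate G h (conjugate G k a) = conjugate G (h \<otimes>\<^bsub>G\<^esub> k) a"
proof -
  interpret group G by fact
  show ?thesis using assms by (simp add: conjugate_def m_assoc inv_mult_group)
qed

lemma conjugate_conjugate_swap:
  assumes "group G" "h \<in> carrier G" "k \<in> carrier G" "a \<in> carrier G"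
  shows "conjugate G h (conjugate G k a) = conjugate G (conjugate G h k) (conjugate G h a)"
proof -
  interpret group G by fact
  have "conjugate G h k \<otimes>\<^bsub>G\<^esub> h = h \<otimes>\<^bsub>G\<^esub> k"
    using assms by (simp add: conjugate_def m_assoc)
  then show ?thesis using assms by (simp add: conjugate_conjugate conjugate_closed)
qed

text \<open>The commutator satisfies the relations of the exterior square.\<close>

lemma wedge_trivial_commute:
  assumes "group G" "x \<in> carrier G" "y \<in> carrier G" "wedge G x y = \<one>\<^bsub>exterior_square G\<^esub>"
  shows "x \<otimes>\<^bsub>G\<^esub> y = y \<otimes>\<^bsub>G\<^esub> x"
proof -
  interpret group G by fact
  define f where "f g h = (g \<otimes>\<^bsub>G\<^esub> h) \<otimes>\<^bsub>G\<^esub> inv\<^bsub>G\<^esub> (h \<otimes>\<^bsub>G\<^esub> g)" for g h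
  have canc: "inv\<^bsub>G\<^esub> a \<otimes>\<^bsub>G\<^esub> (a \<otimes>\<^bsub>G\<^esub> b) = b" "a \<otimes>\<^bsub>G\<^esub> (inv\<^bsub>G\<^esub> a \<otimes>\<^bsub>G\<^esub> b) = b"
    if "a \<in> carrier G" "b \<in> carrier G" for a b
    using that by (simp_all add: inv_solve_left' inv_solve_left flip: m_assoc)
  have "f x y = \<one>\<^bsub>G\<^esub>"
    by (rule wedge_trivial_imp[OF assms(1,1) _ _ _ _ assms(2-4)])
      (simp_all add: f_def conjugate_def m_assoc inv_mult_group canc)
  then have "x \<otimes>\<^bsub>G\<^esub> y = \<one>\<^bsub>G\<^esub> \<otimes>\<^bsub>G\<^esub> (y \<otimes>\<^bsub>G\<^esub> x)"
    using assms by (subst inv_solve_right[symmetric]) (simp_all add: f_def)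
  then show ?thesis using assms by simp
qed

text \<open>Conjugation by \<open>k\<close> is an automorphism of \<open>G\<close>, so the wedge of the conjugates again satisfies
  the defining relations: \<open>G\<close> acts on its exterior square.\<close>

lemma wedge_trivial_conjugate:
  assumes "group G" "k \<in> carrier G" "x \<in> carrier G" "y \<in> carrier G"
    and "wedge G x y = \<one>\<^bsub>exterior_square G\<^esub>"
  shows "wedge G (conjugate G k x) (conjugate G k y) = \<one>\<^bsub>exterior_square G\<^esub>"
proof (rule wedge_trivial_imp[where f = "\<lambda>g h. wedge G (conjugate G k g) (conjugate G k h)",
      OF assms(1) group_exterior_square _ _ _ _ assms(3-5)], goal_cases)
  case (1 g h)
  then show ?case using assms(1,2) by (simp add: wedge_closed conjugate_closed)
next
  case (2 g l h)
  then show ?case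
    using assms(1,2) by (simp add: conjugate_mult wedge_mult_left conjugate_closed
        conjugate_conjugate_swap[of G k g])
next
  case (3 g h l)
  then show ?case
    using assms(1,2) by (simp add: conjugate_mult wedge_mult_right conjugate_closed
        conjugate_conjugate_swap[of G k h])
next
  case (4 g)
  then show ?case using assms(1,2) by (simp add: wedge_self conjugate_closed)
qed

text \<open>With \<open>z = x\<^sup>-\<^sup>1yx\<close>, expanding \<open>xz \<and> xz = 1\<close> by both relations leaves \<open>(y \<and> x)(x \<and> y) = 1\<close>.\<close>

lemma wedge_trivial_sym:
  assumes "group G" "x \<in> carrier G" "y \<in> carrier G" "wedge G x y = \<one>\<^bsub>exterior_square G\<^esub>"
  shows "wedge G y x = \<one>\<^bsub>exterior_square G\<^esub>"
proof -
  interpret group G by fact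
  interpret E: group "exterior_square G" by (rule group_exterior_square)
  define z where "z = conjugate G (inv\<^bsub>G\<^esub> x) y"
  have z: "z \<in> carrier G" "conjugate G x z = y"
    using assms by (simp_all add: z_def conjugate_closed conjugate_conjugate conjugate_one)
  have "wedge G x (x \<otimes>\<^bsub>G\<^esub> z) = wedge G x y"
    using assms z by (simp add: wedge_mult_right wedge_self conjugate_self wedge_closed)
  moreover have "wedge G y (conjugate G x (x \<otimes>\<^bsub>G\<^esub> z)) = wedge G y x"
    using assms z by (simp add: conjugate_mult conjugate_self wedge_mult_right wedge_self
        wedge_closed conjugate_closed)
  ultimately have "wedge G (x \<otimes>\<^bsub>G\<^esub> z) (x \<otimes>\<^bsub>G\<^esub> z) =
      wedge G y x \<otimes>\<^bsub>exterior_square G\<^esub> wedge G x y"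
    using assms z by (simp add: wedge_mult_left)
  then show ?thesis using assms z by (simp add: wedge_self wedge_closed)
qed

text \<open>By \<open>x \<and> yz = (x \<and> y) \<^sup>y(x \<and> z)\<close>, closure under products and inverses both follow
  from the action by conjugation.\<close>

lemma subgroup_exterior_centralizer:
  assumes "group G" "x \<in> carrier G"
  shows "subgroup (exterior_centralizer G x) G"
proof -
  interpret group G by fact
  interpret E: group "exterior_square G" by (rule group_exterior_square)
  have one: "wedge G x \<one>\<^bsub>G\<^esub> = \<one>\<^bsub>exterior_square G\<^esub>"
  proof -
    have "wedge G x \<one>\<^bsub>G\<^esub> = wedge G x \<one>\<^bsub>G\<^esub> \<otimes>\<^bsub>exterior_square G\<^esub> wedge G x \<one>\<^bsub>G\<^esub>"
      using wedge_mult_right[OF assms(1,2), of "\<one>\<^bsub>G\<^esub>" "\<one>\<^bsub>G\<^esub>"] assms by (simp add: conjugate_one)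
    then show ?thesis using assms by (simp add: wedge_closed)
  qed
  have mult: "wedge G x (y \<otimes>\<^bsub>G\<^esub> z) = \<one>\<^bsub>exterior_square G\<^esub>"
    if "y \<in> carrier G" "z \<in> carrier G" "wedge G x y = \<one>\<^bsub>exterior_square G\<^esub>"
      "wedge G x z = \<one>\<^bsub>exterior_square G\<^esub>" for y z
    using that assms by (simp add: wedge_mult_right wedge_trivial_conjugate)
  have inv: "wedge G x (inv\<^bsub>G\<^esub> y) = \<one>\<^bsub>exterior_square G\<^esub>"
    if y: "y \<in> carrier G" "wedge G x y = \<one>\<^bsub>exterior_square G\<^esub>" for y
  proof -
    \<comment> \<open>Expand \<open>x \<and> y y\<^sup>-\<^sup>1 = 1\<close>, then undo the conjugation by \<open>y\<close>.\<close>
    have "wedge G (conjugate G y x) (conjugate G y (inv\<^bsub>G\<^esub> y)) = \<one>\<^bsub>exterior_square G\<^esub>"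
      using wedge_mult_right[OF assms(1,2), of "inv\<^bsub>G\<^esub> y" y] one assms y
      by (simp add: wedge_closed conjugate_closed)
    from wedge_trivial_conjugate[OF assms(1) _ _ _ this, of "inv\<^bsub>G\<^esub> y"]
    show ?thesis using assms y by (simp add: conjugate_closed conjugate_conjugate conjugate_one)
  qed
  show ?thesis
    by (rule subgroup.intro) (auto simp: exterior_centralizer_def mult inv one)
qed

lemma exterior_centralizer_subset_centralizer:
  assumes "group G" "x \<in> carrier G"
  shows "exterior_centralizer G x \<subseteq> {y \<in> carrier G. x \<otimes>\<^bsub>G\<^esub> y = y \<otimes>\<^bsub>G\<^esub> x}"
  using assms wedge_trivial_commute by (auto simp: exterior_centralizer_def)

lemma exterior_center_eq:
  assumes "group G"
  shows "exterior_center G =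
    {y \<in> carrier G. \<forall>x\<in>carrier G. wedge G x y = \<one>\<^bsub>exterior_square G\<^esub>}"
proof -
  have "\<one>\<^bsub>G\<^esub> \<in> carrier G" using assms by (simp add: group.is_monoid)
  then show ?thesis unfolding exterior_center_def exterior_centralizer_def by blast
qed

text \<open>The exterior center controls \<open>y \<and> x\<close>, the exterior centralizer of \<open>x\<close> controls \<open>x \<and> y\<close>;
  symmetry links the two.\<close>

lemma exterior_centralizer_proper:
  assumes "group G" "x \<in> carrier G" "x \<notin> exterior_center G"
  shows "exterior_centralizer G x \<noteq> carrier G"
proof -
  obtain y where y: "y \<in> carrier G" "wedge G y x \<noteq> \<one>\<^bsub>exterior_square G\<^esub>"
    using assms by (auto simp: exterior_center_eq)
  then have "y \<notin> exterior_centralizer G x"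
    using wedge_trivial_sym[OF assms(1,2), of y] by (auto simp: exterior_centralizer_def)
  then show ?thesis using y(1) by auto
qed

lemma exterior_center_subset_center:
  assumes "group G"
  shows "exterior_center G \<subseteq> group_center G"
proof
  fix z assume z: "z \<in> exterior_center G"
  have "z \<otimes>\<^bsub>G\<^esub> x = x \<otimes>\<^bsub>G\<^esub> z" if "x \<in> carrier G" for x
    using wedge_trivial_commute[OF assms that, of z] z that
    by (auto simp: exterior_center_eq[OF assms])
  then show "z \<in> group_center G"
    using z by (auto simp: group_center_def exterior_center_eq[OF assms])
qed

section \<open>Counting\<close>

text \<open>The index is a divisor of the group order different from \<open>1\<close>, so some prime divisor of the
  group order is at most the index.\<close>

lemma proper_subgroup_card_le:
  assumes "group G" "finite (carrier G)" "subgroup K G" "K \<noteq> carrier G"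
    and least: "\<And>q::nat. prime q \<Longrightarrow> q dvd order G \<Longrightarrow> p \<le> q"
  shows "p * card K \<le> order G"
proof -
  interpret group G by fact
  define m where "m = card (rcosets\<^bsub>G\<^esub> K)"
  have lagr: "card K * m = order G" using lagrange[OF assms(3)] by (simp add: m_def mult.commute)
  have K: "K \<subseteq> carrier G" using assms(3) by (rule subgroup.subset)
  have "card K < order G"
    using psubset_card_mono[of "carrier G" K] K assms by (auto simp: order_def)
  then have "m \<noteq> 1" "m \<noteq> 0" using lagr by (auto intro!: Nat.gr0I)
  then obtain q where "prime q" "q dvd m" using prime_factor_nat by blast
  moreover from this have "q dvd order G" unfolding lagr[symmetric] by simp
  ultimately have "p \<le> m" using least[of q] dvd_imp_le[of q m] \<open>m \<noteq> 0\<close> by simp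
  then have "card K * p \<le> order G" unfolding lagr[symmetric] by simp
  then show ?thesis by (simp only: mult.commute)
qed

definition wedge_trivial_tuples :: "('a, 'b) monoid_scheme \<Rightarrow> nat \<Rightarrow> (nat \<Rightarrow> 'a) set" where
  "wedge_trivial_tuples G m = {x \<in> {1..m} \<rightarrow>\<^sub>E carrier G.
    \<forall>i\<in>{1..m}. \<forall>j\<in>{1..m}. wedge G (x i) (x j) = \<one>\<^bsub>exterior_square G\<^esub>}"

lemma finite_wedge_trivial_tuples:
  "finite (carrier G) \<Longrightarrow> finite (wedge_trivial_tuples G m)"
  by (rule finite_subset[of _ "{1..m} \<rightarrow>\<^sub>E carrier G"])
    (auto simp: wedge_trivial_tuples_def intro: finite_PiE)

text \<open>Splitting off the last entry \<open>a\<close> is injective, and all the other entries lie in the exterior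
  centralizer of \<open>a\<close>.\<close>

lemma card_wedge_trivial_tuples_Suc:
  assumes "finite (carrier G)"
  shows "card (wedge_trivial_tuples G (Suc m)) \<le>
    (\<Sum>a\<in>carrier G. card (wedge_trivial_tuples G m \<inter> ({1..m} \<rightarrow>\<^sub>E exterior_centralizer G a)))"
proof -
  let ?S = "SIGMA a:carrier G. wedge_trivial_tuples G m \<inter> ({1..m} \<rightarrow>\<^sub>E exterior_centralizer G a)"
  let ?s = "\<lambda>x. (x (Suc m), restrict x {1..m})"
  have fin: "finite (wedge_trivial_tuples G m \<inter> ({1..m} \<rightarrow>\<^sub>E exterior_centralizer G a))" for a
    using finite_wedge_trivial_tuples[OF assms] by blast
  have "card (wedge_trivial_tuples G (Suc m)) \<le> card ?S"
  proof (rule card_inj_on_le[of ?s])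
    show "inj_on ?s (wedge_trivial_tuples G (Suc m))"
    proof (rule inj_onI)
      fix x y assume xy: "x \<in> wedge_trivial_tuples G (Suc m)"
        "y \<in> wedge_trivial_tuples G (Suc m)" "?s x = ?s y"
      have "x i = y i" if "i \<in> {1..Suc m}" for i
      proof (cases "i = Suc m")
        case False
        then have "i \<in> {1..m}" using that by auto
        then show ?thesis using xy(3) by (metis prod.inject restrict_apply')
      qed (use xy(3) in auto)
      moreover have "x \<in> {1..Suc m} \<rightarrow>\<^sub>E carrier G" "y \<in> {1..Suc m} \<rightarrow>\<^sub>E carrier G"
        using xy(1,2) unfolding wedge_trivial_tuples_def by blast+
      ultimately show "x = y" by (intro PiE_ext)
    qed
    show "?s ` wedge_trivial_tuples G (Suc m) \<subseteq> ?S"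
      by (auto simp: wedge_trivial_tuples_def exterior_centralizer_def PiE_iff)
    show "finite ?S" using assms fin by blast
  qed
  also have "card ?S = (\<Sum>a\<in>carrier G.
      card (wedge_trivial_tuples G m \<inter> ({1..m} \<rightarrow>\<^sub>E exterior_centralizer G a)))"
    using assms fin by simp
  finally show ?thesis .
qed

lemma multiple_exterior_degree_eq:
  "multiple_exterior_degree n G =
    real (card (wedge_trivial_tuples G (Suc n))) / real (order G) ^ Suc n"
  unfolding multiple_exterior_degree_def wedge_trivial_tuples_def Suc_eq_plus1 ..

lemma sum_card_centralizers:
  assumes "finite (carrier G)" "order G > 0"
  shows "(\<Sum>a\<in>carrier G. real (card {y \<in> carrier G. a \<otimes>\<^bsub>G\<^esub> y = y \<otimes>\<^bsub>G\<^esub> a})) =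
    real (order G) ^ 2 * commutativity_degree G"
proof -
  have "{(x, y) \<in> carrier G \<times> carrier G. x \<otimes>\<^bsub>G\<^esub> y = y \<otimes>\<^bsub>G\<^esub> x} =
      (SIGMA a:carrier G. {y \<in> carrier G. a \<otimes>\<^bsub>G\<^esub> y = y \<otimes>\<^bsub>G\<^esub> a})" by auto
  then show ?thesis using assms by (simp add: commutativity_degree_def)
qed

theorem theorem3p6:
  fixes G :: "('a, 'b) monoid_scheme" and p :: nat
  assumes "group G" and "finite (carrier G)"
    and "prime p" and "p dvd order G"
    and "\<And>q::nat. prime q \<Longrightarrow> q dvd order G \<Longrightarrow> p \<le> q"
  shows "\<forall>n\<ge>1. multiple_exterior_degree n G
    \<le> 1 / real p ^ (n - 1) * commutativity_degree G
      + ((1 - real p) * real (card (group_center G))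
          - (1 - real p ^ n * multiple_exterior_degree (n - 1) G) * real (card (exterior_center G)))
        / (real p ^ n * real (order G))"
proof (intro allI impI)
  fix n :: nat assume "1 \<le> n"
  then obtain k where n: "n = Suc k" by (cases n) auto
  interpret group G by fact
  let ?E = "exterior_centralizer G"
  let ?C = "\<lambda>a. {y \<in> carrier G. a \<otimes>\<^bsub>G\<^esub> y = y \<otimes>\<^bsub>G\<^esub> a}"
  let ?W = "exterior_center G" and ?Z = "group_center G"
  let ?T = "\<lambda>a. wedge_trivial_tuples G n \<inter> ({1..n} \<rightarrow>\<^sub>E ?E a)"
  define N where "N = real (order G)"
  define q where "q = N / real p"
  define D where "D = multiple_exterior_degree k G"
  have N: "N > 0" using assms(2) by (simp add: N_def order_gt_0_iff_finite)
  have p: "real p > 0" using assms(3) by (simp add: prime_gt_0_nat)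
  have q: "q \<ge> 0" using N p by (simp add: q_def)
  have WZ: "?W \<subseteq> ?Z" by (rule exterior_center_subset_center[OF assms(1)])
  have ZG: "?Z \<subseteq> carrier G" by (auto simp: group_center_def)
  have finZ: "finite ?Z" by (rule finite_subset[OF ZG assms(2)])
  then have finW: "finite ?W" by (rule finite_subset[OF WZ])
  have tuples: "real (card (wedge_trivial_tuples G n)) = N ^ n * D"
    using N by (simp add: D_def multiple_exterior_degree_eq N_def n)

  have E_le: "real (card (?E a)) \<le> q" if "a \<in> carrier G - ?W" for a
  proof -
    have "p * card (?E a) \<le> order G"
      using that assms(1,2,5)
      by (intro proper_subgroup_card_le)
        (auto simp: subgroup_exterior_centralizer exterior_centralizer_proper)
    then have "real p * real (card (?E a)) \<le> N" unfolding N_def by (metis of_nat_le_iff of_nat_mult)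
    then show ?thesis using p by (simp add: q_def field_simps)
  qed
  have T_le: "real (card (?T a)) \<le> real (card (?E a)) ^ n" if "a \<in> carrier G" for a
  proof -
    have "finite (?E a)"
      using assms(2) by (auto simp: exterior_centralizer_def intro: finite_subset)
    then have "card (?T a) \<le> card ({1..n} \<rightarrow>\<^sub>E ?E a)"
      by (intro card_mono finite_PiE) auto
    also have "\<dots> = card (?E a) ^ n" by (simp add: card_PiE)
    finally show ?thesis by (metis of_nat_le_iff of_nat_power)
  qed

  have W_part: "(\<Sum>a\<in>?W. real (card (?T a))) \<le> real (card ?W) * (N ^ n * D)"
  proof -
    have "real (card (?T a)) \<le> N ^ n * D" for a
      unfolding tuples[symmetric]
      using finite_wedge_trivial_tuples[OF assms(2)] by (intro of_nat_mono card_mono) auto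
    then show ?thesis by (intro sum_bounded_above)
  qed
  have Z_part: "(\<Sum>a\<in>?Z - ?W. real (card (?T a))) \<le> (real (card ?Z) - real (card ?W)) * q ^ n"
  proof -
    have "real (card (?T a)) \<le> q ^ n" if "a \<in> ?Z - ?W" for a
    proof -
      have a: "a \<in> carrier G" "a \<in> carrier G - ?W" using that ZG by auto
      show ?thesis by (rule order.trans[OF T_le[OF a(1)] power_mono[OF E_le[OF a(2)]]]) simp
    qed
    then have "(\<Sum>a\<in>?Z - ?W. real (card (?T a))) \<le> real (card (?Z - ?W)) * q ^ n"
      by (rule sum_bounded_above)
    also have "real (card (?Z - ?W)) = real (card ?Z) - real (card ?W)"
      using finZ finW WZ by (simp add: card_Diff_subset card_mono of_nat_diff)
    finally show ?thesis .
  qed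
  have G_part: "(\<Sum>a\<in>carrier G - ?Z. real (card (?T a))) \<le>
      (N ^ 2 * commutativity_degree G - real (card ?Z) * N) * q ^ k"
  proof -
    have "real (card (?T a)) \<le> real (card (?C a)) * q ^ k" if a: "a \<in> carrier G - ?Z" for a
    proof -
      have "card (?E a) \<le> card (?C a)"
        using a assms(2) exterior_centralizer_subset_centralizer[OF assms(1), of a]
        by (intro card_mono) auto
      moreover have "real (card (?E a)) ^ k \<le> q ^ k"
        using a WZ by (intro power_mono E_le) auto
      ultimately have "real (card (?E a)) ^ n \<le> real (card (?C a)) * q ^ k"
        unfolding n by (simp add: mult_mono)
      with T_le[of a] a show ?thesis by (blast intro: order.trans)
    qed
    then have "(\<Sum>a\<in>carrier G - ?Z. real (card (?T a))) \<le>
        (\<Sum>a\<in>carrier G - ?Z. real (card (?C a))) * q ^ k"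
      unfolding sum_distrib_right by (rule sum_mono)
    also have "(\<Sum>a\<in>carrier G - ?Z. real (card (?C a))) =
        (\<Sum>a\<in>carrier G. real (card (?C a))) - (\<Sum>a\<in>?Z. real (card (?C a)))"
      using assms(2) ZG by (rule sum_diff)
    also have "(\<Sum>a\<in>?Z. real (card (?C a))) = (\<Sum>a\<in>?Z. N)"
    proof (rule sum.cong)
      fix a assume "a \<in> ?Z"
      then have "?C a = carrier G" by (auto simp: group_center_def)
      then show "real (card (?C a)) = N" by (simp add: N_def order_def)
    qed simp
    also have "(\<Sum>a\<in>carrier G. real (card (?C a))) = N ^ 2 * commutativity_degree G"
      using N unfolding N_def by (intro sum_card_centralizers assms(2)) simp
    finally show ?thesis by simp
  qed

  have "N ^ Suc n * multiple_exterior_degree n G = real (card (wedge_trivial_tuples G (Suc n)))"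
    using N by (simp add: multiple_exterior_degree_eq N_def)
  also have "\<dots> \<le> (\<Sum>a\<in>carrier G. real (card (?T a)))"
    using card_wedge_trivial_tuples_Suc[OF assms(2), of n] by (metis (no_types) of_nat_le_iff of_nat_sum)
  also have "\<dots> = (\<Sum>a\<in>carrier G - ?Z. real (card (?T a))) +
      ((\<Sum>a\<in>?Z - ?W. real (card (?T a))) + (\<Sum>a\<in>?W. real (card (?T a))))"
    by (simp only: sum.subset_diff[OF ZG assms(2)] sum.subset_diff[OF WZ finZ])
  also have "\<dots> \<le> (N ^ 2 * commutativity_degree G - real (card ?Z) * N) * q ^ k +
      ((real (card ?Z) - real (card ?W)) * q ^ n + real (card ?W) * (N ^ n * D))"
    using W_part Z_part G_part by linarith
  also have "\<dots> = N ^ Suc n * (1 / real p ^ k * commutativity_degree G +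
      ((1 - real p) * real (card ?Z) - (1 - real p ^ n * D) * real (card ?W)) / (real p ^ n * N))"
    using N p by (simp add: n q_def field_simps power2_eq_square)
  finally show "multiple_exterior_degree n G \<le> 1 / real p ^ (n - 1) * commutativity_degree G
      + ((1 - real p) * real (card ?Z)
          - (1 - real p ^ n * multiple_exterior_degree (n - 1) G) * real (card ?W))
        / (real p ^ n * real (order G))"
    using N by (simp add: n D_def N_def)
qed

end
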